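(* For every GP 2 program $P$ and all assertions $c,d$: if $\{c\}\,P\,\{d\}$ is partially correct (i.e. for every host graph $G$ with $G\models c$ and every host graph $H\in[\![P]\!]G$, $H\models d$), then $\{c\}\,P\,\{d\}$ is provable in the proof calculus $\mathsf{SEM}$.
   Context: GP 2 host graphs have finite node/edge sets, source/target maps, node/edge labels (a list of integers and strings together with a mark) and rooted/unrooted nodes. A conditional rule schema $r$ defines a relation $G\Rightarrow_r H$ on host graphs (rule application via an injective match, label assignment, rule condition, dangling condition and natural double pushout). Programs are built from rule set calls $\mathcal{R}=\{r_1,\dots,r_n\}$, $\mathtt{break}$, $\mathtt{skip}$, $\mathtt{fail}$, $P;Q$, $P\ \mathtt{or}\ Q$, $\mathtt{if}\ C\ \mathtt{then}\ P\ \mathtt{else}\ Q$, $\mathtt{try}\ C\ \mathtt{then}\ P\ \mathtt{else}\ Q$, $P!$. Execution is given by a small-step relation $\to$ on configurations $\langle P,G\rangle$, host graphs and $\mathrm{fail}$; $[\![P]\!]G$ is the set of host graphs and $\mathrm{fail}$ reachable from $\langle P,G\rangle$ by $\to^+$, plus $\bot$ if $P$ can diverge or get stuck. Key facts: a rule set call yields every $H$ with $G\Rightarrow_r H$, $r\in\mathcal{R}$, or $\mathrm{fail}$ if none exists; $\mathtt{if}\ C\ \mathtt{then}\ P\ \mathtt{else}\ Q$ continues with $\langle P,G\rangle$ if $\langle C,G\rangle\to^+H$ for some graph $H$ and with $\langle Q,G\rangle$ if $\langle C,G\rangle\to^+\mathrm{fail}$; $\mathtt{try}$ is the same except that it continues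 with $\langle P,H\rangle$; $\langle P!,G\rangle\to\langle P!,H\rangle$ if $\langle P,G\rangle\to^+H$, $\langle P!,G\rangle\to G$ if $\langle P,G\rangle\to^+\mathrm{fail}$, and $\langle P!,G\rangle\to H$ if $\langle P,G\rangle\to^*\langle\mathtt{break},H\rangle$. Outside loops $\mathtt{break}$ is treated as $\mathtt{skip}$. Assertions are arbitrary properties of host graphs; $G\models c$ means $G$ has property $c$; $\wedge,\vee$ and "implies" are understood semantically. $G\models\mathrm{SUCCESS}(P)$ iff some host graph $H\in[\![P]\!]G$; $G\models\mathrm{FAIL}(P)$ iff $\mathrm{fail}\in[\![P]\!]G$. $\mathrm{SLP}(c,r)$ is a strongest liberal postcondition: it holds of $H$ whenever $G\models c$ and $G\Rightarrow_r H$, and implies every assertion with this property. $\mathrm{WLP}(r,d)$ is a weakest liberal precondition: $G\models c$ and $G\Rightarrow_r H$ imply $H\models d$ for $c=\mathrm{WLP}(r,d)$, and it is implied by every $c$ with this property. $\mathrm{Break}(c,P,d)$ holds iff for all derivations $\langle P,G\rangle\to^*\langle\mathtt{break},H\rangle$, $G\models c$ implies $H\models d$. The calculus $\mathsf{SEM}$ consists of: [ruleapp]$_{\mathrm{slp}}$: $\{c\}\,r\,\{\mathrm{SLP}(c,r)\}$; [ruleapp]$_{\mathrm{wlp}}$: $\{\mathrm{WLP}(r,d)\}\,r\,\{d\}$; [ruleset]: from $\{c\}\,r\,\{d\}$ for each $r\in\mathcal{R}$ infer $\{c\}\,\mathcal{R}\,\{d\}$; [comp]: from $\{c\}\,P\,\{e\}$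 and $\{e\}\,Q\,\{d\}$ infer $\{c\}\,P;Q\,\{d\}$; [cons]: from "$c$ implies $c'$", $\{c'\}\,P\,\{d'\}$ and "$d'$ implies $d$" infer $\{c\}\,P\,\{d\}$ (the implications being semantic, which is the sense of relative completeness); [if]: from $\{c\wedge\mathrm{SUCCESS}(C)\}\,P\,\{d\}$ and $\{c\wedge\mathrm{FAIL}(C)\}\,Q\,\{d\}$ infer $\{c\}\,\mathtt{if}\ C\ \mathtt{then}\ P\ \mathtt{else}\ Q\,\{d\}$; [try]: from $\{c\wedge\mathrm{SUCCESS}(C)\}\,C;P\,\{d\}$ and $\{c\wedge\mathrm{FAIL}(C)\}\,Q\,\{d\}$ infer $\{c\}\,\mathtt{try}\ C\ \mathtt{then}\ P\ \mathtt{else}\ Q\,\{d\}$; [alap]: from $\{c\}\,P\,\{c\}$ and $\mathrm{Break}(c,P,d)$ infer $\{c\}\,P!\,\{(c\wedge\mathrm{FAIL}(P))\vee d\}$. A triple is provable if it is the root of a finite proof tree built from these axioms and rules.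
   Formalization: SEM as listed has no rule for skip, fail, or, break, so {false} skip {true} is unprovable; proved instead: provability in SEM for programs without these commands (except in if-conditions), and for all programs in SEM plus {c}skip{c}, {c}fail{d}, {c}break{d} and a rule for or. *)

theory Defs
  imports "HOL-Library.FSet" "HOL-Library.FuncSet" "HOL-Library.Signed_Division"
begin

section \<open>Graphs, morphisms and natural pushouts\<close>

type_synonym id = nat

text \<open>
  Node labels and rootedness are partial: interface graphs and the intermediate graphs of
  derivations are not totally labelled. Functions are extensional outside the carrier, so that
  equality of graphs and of morphisms is HOL equality.
\<close>

record ('n, 'e) graph =
  nodes :: "id set"
  edges :: "id set"
  src :: "id \<Rightarrow> id"
  tgt :: "id \<Rightarrow> id"
  nlab :: "id \<Rightarrow> 'n option"
  elab :: "id \<Rightarrow> 'e"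
  root :: "id \<Rightarrow> bool option"

definition wf_graph :: "('n, 'e) graph \<Rightarrow> bool" where
  "wf_graph G \<longleftrightarrow>
     finite (nodes G) \<and> finite (edges G) \<and>
     src G \<in> edges G \<rightarrow>\<^sub>E nodes G \<and> tgt G \<in> edges G \<rightarrow>\<^sub>E nodes G \<and>
     dom (nlab G) \<subseteq> nodes G \<and> elab G \<in> edges G \<rightarrow>\<^sub>E UNIV \<and> dom (root G) \<subseteq> nodes G"

definition total_graph :: "('n, 'e) graph \<Rightarrow> bool" where
  "total_graph G \<longleftrightarrow> wf_graph G \<and> dom (nlab G) = nodes G \<and> dom (root G) = nodes G"

definition empty_graph :: "('n, 'e) graph" where
  "empty_graph = \<lparr>nodes = {}, edges = {}, src = \<lambda>_. undefined, tgt = \<lambda>_. undefined,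
     nlab = Map.empty, elab = \<lambda>_. undefined, root = Map.empty\<rparr>"

lemma total_empty_graph: "total_graph empty_graph"
  by (simp add: total_graph_def wf_graph_def empty_graph_def)

type_synonym morph = "(id \<Rightarrow> id) \<times> (id \<Rightarrow> id)"

definition morphism :: "morph \<Rightarrow> ('n, 'e) graph \<Rightarrow> ('n, 'e) graph \<Rightarrow> bool" where
  "morphism f G H \<longleftrightarrow>
     fst f \<in> nodes G \<rightarrow>\<^sub>E nodes H \<and> snd f \<in> edges G \<rightarrow>\<^sub>E edges H \<and>
     (\<forall>e\<in>edges G. src H (snd f e) = fst f (src G e) \<and> tgt H (snd f e) = fst f (tgt G e) \<and>
        elab H (snd f e) = elab G e) \<and>
     (\<forall>v\<in>dom (nlab G). nlab H (fst f v) = nlab G v) \<and>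
     (\<forall>v\<in>dom (root G). root H (fst f v) = root G v)"

definition injective :: "morph \<Rightarrow> ('n, 'e) graph \<Rightarrow> bool" where
  "injective f G \<longleftrightarrow> inj_on (fst f) (nodes G) \<and> inj_on (snd f) (edges G)"

definition mcomp :: "('n, 'e) graph \<Rightarrow> morph \<Rightarrow> morph \<Rightarrow> morph" where
  "mcomp G g f = (compose (nodes G) (fst g) (fst f), compose (edges G) (snd g) (snd f))"

definition inclusion :: "('n, 'e) graph \<Rightarrow> morph" where
  "inclusion G = (\<lambda>v\<in>nodes G. v, \<lambda>e\<in>edges G. e)"

text \<open>The square consists of f: K to A, g: K to B, f': A to C and g': B to C.\<close>

definition commuting_square ::
  "('n, 'e) graph \<Rightarrow> ('n, 'e) graph \<Rightarrow> ('n, 'e) graph \<Rightarrow> ('n, 'e) graph \<Rightarrow>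
   morph \<Rightarrow> morph \<Rightarrow> morph \<Rightarrow> morph \<Rightarrow> bool" where
  "commuting_square K A B C f g f' g' \<longleftrightarrow>
     morphism f K A \<and> morphism g K B \<and> morphism f' A C \<and> morphism g' B C \<and>
     mcomp K f' f = mcomp K g' g"

definition pushout ::
  "('n, 'e) graph \<Rightarrow> ('n, 'e) graph \<Rightarrow> ('n, 'e) graph \<Rightarrow> ('n, 'e) graph \<Rightarrow>
   morph \<Rightarrow> morph \<Rightarrow> morph \<Rightarrow> morph \<Rightarrow> bool" where
  "pushout K A B C f g f' g' \<longleftrightarrow>
     commuting_square K A B C f g f' g' \<and>
     (\<forall>X p q. wf_graph X \<and> morphism p A X \<and> morphism q B X \<and> mcomp K p f = mcomp K q g \<longrightarrow>
        (\<exists>!u. morphism u C X \<and> mcomp A u f' = p \<and> mcomp B u g' = q))"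

definition pullback ::
  "('n, 'e) graph \<Rightarrow> ('n, 'e) graph \<Rightarrow> ('n, 'e) graph \<Rightarrow> ('n, 'e) graph \<Rightarrow>
   morph \<Rightarrow> morph \<Rightarrow> morph \<Rightarrow> morph \<Rightarrow> bool" where
  "pullback K A B C f g f' g' \<longleftrightarrow>
     commuting_square K A B C f g f' g' \<and>
     (\<forall>X p q. wf_graph X \<and> morphism p X A \<and> morphism q X B \<and> mcomp X f' p = mcomp X g' q \<longrightarrow>
        (\<exists>!u. morphism u X K \<and> mcomp X f u = p \<and> mcomp X g u = q))"

definition natural_pushout ::
  "('n, 'e) graph \<Rightarrow> ('n, 'e) graph \<Rightarrow> ('n, 'e) graph \<Rightarrow> ('n, 'e) graph \<Rightarrow>
   morph \<Rightarrow> morph \<Rightarrow> morph \<Rightarrow> morph \<Rightarrow> bool" where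
  "natural_pushout K A B C f g f' g' \<longleftrightarrow>
     pushout K A B C f g f' g' \<and> pullback K A B C f g f' g'"

text \<open>The rule is given by the inclusions of K into L and into R; g is the match of L in G.\<close>

definition natural_double_pushout ::
  "('n, 'e) graph \<Rightarrow> ('n, 'e) graph \<Rightarrow> ('n, 'e) graph \<Rightarrow> morph \<Rightarrow>
   ('n, 'e) graph \<Rightarrow> ('n, 'e) graph \<Rightarrow> bool" where
  "natural_double_pushout L K R g G H \<longleftrightarrow>
     (\<exists>D k b b' h. wf_graph D \<and> injective h R \<and>
        natural_pushout K L D G (inclusion K) k g b \<and>
        natural_pushout K R D H (inclusion K) k h b')"

definition dangling_condition ::
  "('n, 'e) graph \<Rightarrow> ('n, 'e) graph \<Rightarrow> morph \<Rightarrow> ('n, 'e) graph \<Rightarrow> bool" where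
  "dangling_condition L K g G \<longleftrightarrow>
     (\<forall>e \<in> edges G - snd g ` edges L.
        src G e \<notin> fst g ` (nodes L - nodes K) \<and> tgt G e \<notin> fst g ` (nodes L - nodes K))"


section \<open>Host graphs\<close>

datatype atom = AtInt int | AtStr string

datatype node_mark = NNone | NRed | NGreen | NBlue | NGrey
datatype edge_mark = ENone | ERed | EGreen | EBlue | EDashed

type_synonym host_node_label = "atom list \<times> node_mark"
type_synonym host_edge_label = "atom list \<times> edge_mark"

typedef host_graph = "{G :: (host_node_label, host_edge_label) graph. total_graph G}"
  morphisms graph_of Host_graph
  using total_empty_graph by blast


section \<open>Conditional rule schemata\<close>

text \<open>
  Variables are typed by the constructor in which they occur; equally named variables of
  different types are different variables. Negative integer constants are instances of
  \<open>IConst\<close>; \<open>INeg\<close> is the operator.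
\<close>

type_synonym name = string

datatype arith_op = OpAdd | OpSub | OpMul | OpDiv

datatype iexp =
    IConst int | IVar name | INeg iexp | IArith arith_op iexp iexp
  | IIndeg id | IOutdeg id | ILenString name | ILenAtom name | ILenList name

datatype sexp = SConst string | CVar name | SVar name | SConcat sexp sexp

datatype aexp = AInt iexp | AStr sexp | AVar name

datatype lexp = LEmpty | LAtom aexp | LVar name | LAppend lexp lexp

datatype 'm rule_mark = Mark 'm | Any

type_synonym rule_node_label = "lexp \<times> node_mark rule_mark"
type_synonym rule_edge_label = "lexp \<times> edge_mark rule_mark"
type_synonym rule_graph = "(rule_node_label, rule_edge_label) graph"

datatype rel_op = RLess | RLeq | RGreater | RGeq

datatype rule_cond =
    BInt lexp | BChar lexp | BString lexp | BAtom lexp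
  | BEq lexp lexp | BNeq lexp lexp | BRel rel_op iexp iexp
  | BEdge id id "rule_edge_label option"
  | BNot rule_cond | BAnd rule_cond rule_cond | BOr rule_cond rule_cond

datatype var = VInt name | VChar name | VString name | VAtom name | VList name

primrec ivars :: "iexp \<Rightarrow> var set" where
  "ivars (IConst i) = {}"
| "ivars (IVar x) = {VInt x}"
| "ivars (INeg e) = ivars e"
| "ivars (IArith f e1 e2) = ivars e1 \<union> ivars e2"
| "ivars (IIndeg v) = {}"
| "ivars (IOutdeg v) = {}"
| "ivars (ILenString x) = {VString x}"
| "ivars (ILenAtom x) = {VAtom x}"
| "ivars (ILenList x) = {VList x}"

primrec svars :: "sexp \<Rightarrow> var set" where
  "svars (SConst s) = {}"
| "svars (CVar x) = {VChar x}"
| "svars (SVar x) = {VString x}"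
| "svars (SConcat e1 e2) = svars e1 \<union> svars e2"

primrec avars :: "aexp \<Rightarrow> var set" where
  "avars (AInt e) = ivars e"
| "avars (AStr e) = svars e"
| "avars (AVar x) = {VAtom x}"

primrec lvars :: "lexp \<Rightarrow> var set" where
  "lvars LEmpty = {}"
| "lvars (LAtom e) = avars e"
| "lvars (LVar x) = {VList x}"
| "lvars (LAppend e1 e2) = lvars e1 \<union> lvars e2"

primrec bvars :: "rule_cond \<Rightarrow> var set" where
  "bvars (BInt e) = lvars e"
| "bvars (BChar e) = lvars e"
| "bvars (BString e) = lvars e"
| "bvars (BAtom e) = lvars e"
| "bvars (BEq e1 e2) = lvars e1 \<union> lvars e2"
| "bvars (BNeq e1 e2) = lvars e1 \<union> lvars e2"
| "bvars (BRel f e1 e2) = ivars e1 \<union> ivars e2"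
| "bvars (BEdge v w l) = (case l of None \<Rightarrow> {} | Some (e, m) \<Rightarrow> lvars e)"
| "bvars (BNot b) = bvars b"
| "bvars (BAnd b1 b2) = bvars b1 \<union> bvars b2"
| "bvars (BOr b1 b2) = bvars b1 \<union> bvars b2"

text \<open>The nodes that an expression or condition refers to.\<close>

primrec irefs :: "iexp \<Rightarrow> id set" where
  "irefs (IConst i) = {}"
| "irefs (IVar x) = {}"
| "irefs (INeg e) = irefs e"
| "irefs (IArith f e1 e2) = irefs e1 \<union> irefs e2"
| "irefs (IIndeg v) = {v}"
| "irefs (IOutdeg v) = {v}"
| "irefs (ILenString x) = {}"
| "irefs (ILenAtom x) = {}"
| "irefs (ILenList x) = {}"

primrec lrefs :: "lexp \<Rightarrow> id set" where
  "lrefs LEmpty = {}"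
| "lrefs (LAtom e) = (case e of AInt i \<Rightarrow> irefs i | _ \<Rightarrow> {})"
| "lrefs (LVar x) = {}"
| "lrefs (LAppend e1 e2) = lrefs e1 \<union> lrefs e2"

primrec brefs :: "rule_cond \<Rightarrow> id set" where
  "brefs (BInt e) = lrefs e"
| "brefs (BChar e) = lrefs e"
| "brefs (BString e) = lrefs e"
| "brefs (BAtom e) = lrefs e"
| "brefs (BEq e1 e2) = lrefs e1 \<union> lrefs e2"
| "brefs (BNeq e1 e2) = lrefs e1 \<union> lrefs e2"
| "brefs (BRel f e1 e2) = irefs e1 \<union> irefs e2"
| "brefs (BEdge v w l) = {v, w} \<union> (case l of None \<Rightarrow> {} | Some (e, m) \<Rightarrow> lrefs e)"
| "brefs (BNot b) = brefs b"
| "brefs (BAnd b1 b2) = brefs b1 \<union> brefs b2"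
| "brefs (BOr b1 b2) = brefs b1 \<union> brefs b2"

text \<open>
  Simple expressions, the only ones allowed in left-hand sides: no operators on integers, no
  degrees or lengths, at most one occurrence of a string variable in each string expression, and
  at most one occurrence of a list variable.
\<close>

primrec string_var_occs :: "sexp \<Rightarrow> nat" where
  "string_var_occs (SConst s) = 0"
| "string_var_occs (CVar x) = 0"
| "string_var_occs (SVar x) = 1"
| "string_var_occs (SConcat e1 e2) = string_var_occs e1 + string_var_occs e2"

primrec list_var_occs :: "lexp \<Rightarrow> nat" where
  "list_var_occs LEmpty = 0"
| "list_var_occs (LAtom e) = 0"
| "list_var_occs (LVar x) = 1"
| "list_var_occs (LAppend e1 e2) = list_var_occs e1 + list_var_occs e2"

primrec simple_atom :: "aexp \<Rightarrow> bool" where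
  "simple_atom (AInt e) = (case e of IConst i \<Rightarrow> True | IVar x \<Rightarrow> True | _ \<Rightarrow> False)"
| "simple_atom (AStr e) = (string_var_occs e \<le> 1)"
| "simple_atom (AVar x) = True"

primrec simple_atoms :: "lexp \<Rightarrow> bool" where
  "simple_atoms LEmpty = True"
| "simple_atoms (LAtom e) = simple_atom e"
| "simple_atoms (LVar x) = True"
| "simple_atoms (LAppend e1 e2) = (simple_atoms e1 \<and> simple_atoms e2)"

definition simple :: "lexp \<Rightarrow> bool" where
  "simple e \<longleftrightarrow> simple_atoms e \<and> list_var_occs e \<le> 1"

definition graph_lexps :: "rule_graph \<Rightarrow> lexp set" where
  "graph_lexps X = fst ` ran (nlab X) \<union> fst ` elab X ` edges X"

definition graph_vars :: "rule_graph \<Rightarrow> var set" where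
  "graph_vars X = (\<Union>e\<in>graph_lexps X. lvars e)"

text \<open>
  The interface of a rule schema consists of unlabelled nodes of undefined rootedness, shared by
  both sides; it has no edges. An edge identifier common to both sides only serves to connect
  the two occurrences of a wildcard mark.
\<close>

record rule_schema =
  lhs :: rule_graph
  interface :: "id set"
  rhs :: rule_graph
  rcond :: "rule_cond option"

definition wf_rule :: "rule_schema \<Rightarrow> bool" where
  "wf_rule r \<longleftrightarrow>
     total_graph (lhs r) \<and> total_graph (rhs r) \<and>
     interface r \<subseteq> nodes (lhs r) \<and> interface r \<subseteq> nodes (rhs r) \<and>
     (\<forall>e\<in>graph_lexps (lhs r). simple e) \<and>
     graph_vars (rhs r) \<subseteq> graph_vars (lhs r) \<and>
     (\<forall>e\<in>graph_lexps (rhs r). lrefs e \<subseteq> nodes (lhs r)) \<and>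
     (\<forall>b. rcond r = Some b \<longrightarrow> bvars b \<subseteq> graph_vars (lhs r) \<and> brefs b \<subseteq> nodes (lhs r)) \<and>
     (\<forall>v\<in>nodes (rhs r). map_option snd (nlab (rhs r) v) = Some Any \<longrightarrow>
        v \<in> interface r \<and> map_option snd (nlab (lhs r) v) = Some Any) \<and>
     (\<forall>e\<in>edges (rhs r). snd (elab (rhs r) e) = Any \<longrightarrow>
        e \<in> edges (lhs r) \<and> snd (elab (lhs r) e) = Any)"

typedef rule = "{r. wf_rule r}"
  morphisms schema_of Rule
proof
  show "\<lparr>lhs = empty_graph, interface = {}, rhs = empty_graph, rcond = None\<rparr> \<in> {r. wf_rule r}"
    by (simp add: wf_rule_def total_empty_graph)
       (simp add: graph_vars_def graph_lexps_def empty_graph_def)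
qed


section \<open>Rule application\<close>

text \<open>
  A label assignment gives values to the variables, and marks to the items marked with the
  wildcard. Evaluation is partial because of division by zero; degrees are taken in the host
  graph, at the image of the node under the match.
\<close>

record assignment =
  ints :: "name \<Rightarrow> int"
  chars :: "name \<Rightarrow> char"
  strings :: "name \<Rightarrow> string"
  atoms :: "name \<Rightarrow> atom"
  lists :: "name \<Rightarrow> atom list"
  nmarks :: "id \<Rightarrow> node_mark"
  emarks :: "id \<Rightarrow> edge_mark"

primrec arith :: "arith_op \<Rightarrow> int \<Rightarrow> int \<Rightarrow> int option" where
  "arith OpAdd i j = Some (i + j)"
| "arith OpSub i j = Some (i - j)"
| "arith OpMul i j = Some (i * j)"
| "arith OpDiv i j = (if j = 0 then None else Some (i sdiv j))"

definition lift2 :: "('a \<Rightarrow> 'b \<Rightarrow> 'c) \<Rightarrow> 'a option \<Rightarrow> 'b option \<Rightarrow> 'c option" where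
  "lift2 f x y = Option.bind x (\<lambda>a. Option.bind y (\<lambda>b. Some (f a b)))"

primrec ieval :: "('n, 'e) graph \<Rightarrow> morph \<Rightarrow> assignment \<Rightarrow> iexp \<Rightarrow> int option" where
  "ieval G g \<alpha> (IConst i) = Some i"
| "ieval G g \<alpha> (IVar x) = Some (ints \<alpha> x)"
| "ieval G g \<alpha> (INeg e) = map_option uminus (ieval G g \<alpha> e)"
| "ieval G g \<alpha> (IArith f e1 e2) =
     Option.bind (ieval G g \<alpha> e1) (\<lambda>i. Option.bind (ieval G g \<alpha> e2) (arith f i))"
| "ieval G g \<alpha> (IIndeg v) = Some (int (card {e \<in> edges G. tgt G e = fst g v}))"
| "ieval G g \<alpha> (IOutdeg v) = Some (int (card {e \<in> edges G. src G e = fst g v}))"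
| "ieval G g \<alpha> (ILenString x) = Some (int (length (strings \<alpha> x)))"
| "ieval G g \<alpha> (ILenAtom x) = Some 1"
| "ieval G g \<alpha> (ILenList x) = Some (int (length (lists \<alpha> x)))"

primrec seval :: "assignment \<Rightarrow> sexp \<Rightarrow> string" where
  "seval \<alpha> (SConst s) = s"
| "seval \<alpha> (CVar x) = [chars \<alpha> x]"
| "seval \<alpha> (SVar x) = strings \<alpha> x"
| "seval \<alpha> (SConcat e1 e2) = seval \<alpha> e1 @ seval \<alpha> e2"

primrec aeval :: "('n, 'e) graph \<Rightarrow> morph \<Rightarrow> assignment \<Rightarrow> aexp \<Rightarrow> atom option" where
  "aeval G g \<alpha> (AInt e) = map_option AtInt (ieval G g \<alpha> e)"
| "aeval G g \<alpha> (AStr e) = Some (AtStr (seval \<alpha> e))"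
| "aeval G g \<alpha> (AVar x) = Some (atoms \<alpha> x)"

primrec leval :: "('n, 'e) graph \<Rightarrow> morph \<Rightarrow> assignment \<Rightarrow> lexp \<Rightarrow> atom list option" where
  "leval G g \<alpha> LEmpty = Some []"
| "leval G g \<alpha> (LAtom e) = map_option (\<lambda>a. [a]) (aeval G g \<alpha> e)"
| "leval G g \<alpha> (LVar x) = Some (lists \<alpha> x)"
| "leval G g \<alpha> (LAppend e1 e2) = lift2 (@) (leval G g \<alpha> e1) (leval G g \<alpha> e2)"

primrec rel :: "rel_op \<Rightarrow> int \<Rightarrow> int \<Rightarrow> bool" where
  "rel RLess i j = (i < j)"
| "rel RLeq i j = (i \<le> j)"
| "rel RGreater i j = (i > j)"
| "rel RGeq i j = (i \<ge> j)"

text \<open>The wildcard stands for the marks other than \<^emph>\<open>none\<close>.\<close>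

definition edge_between ::
  "('n, host_edge_label) graph \<Rightarrow> id \<Rightarrow> id \<Rightarrow> (host_edge_label \<Rightarrow> bool) \<Rightarrow> bool" where
  "edge_between G v w p \<longleftrightarrow> (\<exists>e\<in>edges G. src G e = v \<and> tgt G e = w \<and> p (elab G e))"

fun beval ::
  "('n, host_edge_label) graph \<Rightarrow> morph \<Rightarrow> assignment \<Rightarrow> rule_cond \<Rightarrow> bool option" where
  "beval G g \<alpha> (BInt e) = map_option (\<lambda>l. \<exists>i. l = [AtInt i]) (leval G g \<alpha> e)"
| "beval G g \<alpha> (BChar e) = map_option (\<lambda>l. \<exists>x. l = [AtStr [x]]) (leval G g \<alpha> e)"
| "beval G g \<alpha> (BString e) = map_option (\<lambda>l. \<exists>s. l = [AtStr s]) (leval G g \<alpha> e)"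
| "beval G g \<alpha> (BAtom e) = map_option (\<lambda>l. \<exists>a. l = [a]) (leval G g \<alpha> e)"
| "beval G g \<alpha> (BEq e1 e2) = lift2 (=) (leval G g \<alpha> e1) (leval G g \<alpha> e2)"
| "beval G g \<alpha> (BNeq e1 e2) = lift2 (\<noteq>) (leval G g \<alpha> e1) (leval G g \<alpha> e2)"
| "beval G g \<alpha> (BRel f e1 e2) = lift2 (rel f) (ieval G g \<alpha> e1) (ieval G g \<alpha> e2)"
| "beval G g \<alpha> (BEdge v w None) = Some (edge_between G (fst g v) (fst g w) (\<lambda>_. True))"
| "beval G g \<alpha> (BEdge v w (Some (e, Mark m))) =
     map_option (\<lambda>l. edge_between G (fst g v) (fst g w) (\<lambda>k. k = (l, m))) (leval G g \<alpha> e)"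
| "beval G g \<alpha> (BEdge v w (Some (e, Any))) =
     map_option (\<lambda>l. edge_between G (fst g v) (fst g w) (\<lambda>k. fst k = l \<and> snd k \<noteq> ENone))
       (leval G g \<alpha> e)"
| "beval G g \<alpha> (BNot b) = map_option Not (beval G g \<alpha> b)"
| "beval G g \<alpha> (BAnd b1 b2) = lift2 (\<and>) (beval G g \<alpha> b1) (beval G g \<alpha> b2)"
| "beval G g \<alpha> (BOr b1 b2) = lift2 (\<or>) (beval G g \<alpha> b1) (beval G g \<alpha> b2)"

primrec mark_value :: "'m \<Rightarrow> 'm rule_mark \<Rightarrow> 'm" where
  "mark_value a (Mark m) = m"
| "mark_value a Any = a"

definition label_value ::
  "('n, 'e) graph \<Rightarrow> morph \<Rightarrow> assignment \<Rightarrow> 'm \<Rightarrow> lexp \<times> 'm rule_mark \<Rightarrow> (atom list \<times> 'm) option"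
  where
  "label_value G g \<alpha> a l = map_option (\<lambda>x. (x, mark_value a (snd l))) (leval G g \<alpha> (fst l))"

text \<open>The instance of a rule graph, which requires all its labels to have a value.\<close>

definition is_instance ::
  "('n, 'e) graph \<Rightarrow> morph \<Rightarrow> assignment \<Rightarrow> rule_graph \<Rightarrow>
   (host_node_label, host_edge_label) graph \<Rightarrow> bool" where
  "is_instance G g \<alpha> X Y \<longleftrightarrow>
     total_graph Y \<and> nodes Y = nodes X \<and> edges Y = edges X \<and>
     src Y = src X \<and> tgt Y = tgt X \<and> root Y = root X \<and>
     (\<forall>v\<in>nodes X. nlab Y v = label_value G g \<alpha> (nmarks \<alpha> v) (the (nlab X v))) \<and>
     (\<forall>e\<in>edges X. Some (elab Y e) = label_value G g \<alpha> (emarks \<alpha> e) (elab X e))"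

definition interface_graph :: "id set \<Rightarrow> ('n, 'e) graph" where
  "interface_graph V = empty_graph\<lparr>nodes := V\<rparr>"

definition rule_step :: "rule \<Rightarrow> host_graph \<Rightarrow> host_graph \<Rightarrow> bool" where
  "rule_step \<rho> G H \<longleftrightarrow>
     (let r = schema_of \<rho>; G' = graph_of G; H' = graph_of H; K = interface_graph (interface r) in
       \<exists>g \<alpha> L R.
         (\<forall>v. nmarks \<alpha> v \<noteq> NNone) \<and> (\<forall>e. emarks \<alpha> e \<noteq> ENone) \<and>
         is_instance G' g \<alpha> (lhs r) L \<and> is_instance G' g \<alpha> (rhs r) R \<and>
         morphism g L G' \<and> injective g L \<and>
         (\<forall>b. rcond r = Some b \<longrightarrow> beval G' g \<alpha> b = Some True) \<and>
         dangling_condition L K g G' \<and>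
         natural_double_pushout L K R g G' H')"


section \<open>Programs and their semantics\<close>

datatype prog =
    Call "rule fset"
  | Break
  | Skip
  | Fail
  | Seq prog prog
  | Or prog prog
  | If prog prog prog
  | Try prog prog prog
  | Alap prog

datatype config = Cmd prog host_graph | Graph host_graph | Failure

lemma mono_tranclp [mono]:
  assumes "\<And>a b. x a b \<longrightarrow> y a b"
  shows "x\<^sup>+\<^sup>+ a b \<longrightarrow> y\<^sup>+\<^sup>+ a b"
proof
  assume "x\<^sup>+\<^sup>+ a b"
  then show "y\<^sup>+\<^sup>+ a b"
    by induction (use assms in \<open>blast intro: tranclp.intros\<close>)+
qed

inductive step :: "config \<Rightarrow> config \<Rightarrow> bool" (infix "\<leadsto>" 50) where
  call1: "r |\<in>| R \<Longrightarrow> rule_step r G H \<Longrightarrow> Cmd (Call R) G \<leadsto> Graph H"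
| call2: "(\<And>r H. r |\<in>| R \<Longrightarrow> \<not> rule_step r G H) \<Longrightarrow> Cmd (Call R) G \<leadsto> Failure"
| seq1: "Cmd P G \<leadsto> Cmd P' H \<Longrightarrow> Cmd (Seq P Q) G \<leadsto> Cmd (Seq P' Q) H"
| seq2: "Cmd P G \<leadsto> Graph H \<Longrightarrow> Cmd (Seq P Q) G \<leadsto> Cmd Q H"
| seq3: "Cmd P G \<leadsto> Failure \<Longrightarrow> Cmd (Seq P Q) G \<leadsto> Failure"
| break: "Cmd (Seq Break Q) G \<leadsto> Cmd Break G"
| if1: "step\<^sup>+\<^sup>+ (Cmd C G) (Graph H) \<Longrightarrow> Cmd (If C P Q) G \<leadsto> Cmd P G"
| if2: "step\<^sup>+\<^sup>+ (Cmd C G) Failure \<Longrightarrow> Cmd (If C P Q) G \<leadsto> Cmd Q G"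
| try1: "step\<^sup>+\<^sup>+ (Cmd C G) (Graph H) \<Longrightarrow> Cmd (Try C P Q) G \<leadsto> Cmd P H"
| try2: "step\<^sup>+\<^sup>+ (Cmd C G) Failure \<Longrightarrow> Cmd (Try C P Q) G \<leadsto> Cmd Q G"
| alap1: "step\<^sup>+\<^sup>+ (Cmd P G) (Graph H) \<Longrightarrow> Cmd (Alap P) G \<leadsto> Cmd (Alap P) H"
| alap2: "step\<^sup>+\<^sup>+ (Cmd P G) Failure \<Longrightarrow> Cmd (Alap P) G \<leadsto> Graph G"
| alap3: "step\<^sup>*\<^sup>* (Cmd P G) (Cmd Break H) \<Longrightarrow> Cmd (Alap P) G \<leadsto> Graph H"
| or1: "Cmd (Or P Q) G \<leadsto> Cmd P G"
| or2: "Cmd (Or P Q) G \<leadsto> Cmd Q G"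
| skip: "Cmd Skip G \<leadsto> Graph G"
| fail: "Cmd Fail G \<leadsto> Failure"

definition diverges :: "prog \<Rightarrow> host_graph \<Rightarrow> bool" where
  "diverges P G \<longleftrightarrow> (\<exists>s. s 0 = Cmd P G \<and> (\<forall>i :: nat. s i \<leadsto> s (Suc i)))"

definition gets_stuck :: "prog \<Rightarrow> host_graph \<Rightarrow> bool" where
  "gets_stuck P G \<longleftrightarrow> (\<exists>Q H. step\<^sup>*\<^sup>* (Cmd P G) (Cmd Q H) \<and> (\<nexists>k. Cmd Q H \<leadsto> k))"

datatype outcome = Result host_graph | Failed | Bottom

definition sem :: "prog \<Rightarrow> host_graph \<Rightarrow> outcome set" where
  "sem P G = {Result H |H. step\<^sup>+\<^sup>+ (Cmd P G) (Graph H)} \<union>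
     {Failed |_ :: unit. step\<^sup>+\<^sup>+ (Cmd P G) Failure} \<union>
     {Bottom |_ :: unit. diverges P G \<or> gets_stuck P G}"

text \<open>
  In the step relation a configuration whose program is \<open>Break\<close> is final: it is consumed by the
  enclosing loop. The convention that break outside of loops acts as skip is applied to whole
  programs, by the following replacement. It cannot be a rule of the step relation or of
  \<open>sem\<close>, as both also concern loop bodies: there, \<open>Seq Break Q\<close> has to end the loop without
  contributing a result or a failure of the body.
\<close>

primrec skip_outer_breaks :: "prog \<Rightarrow> prog" where
  "skip_outer_breaks (Call R) = Call R"
| "skip_outer_breaks Break = Skip"
| "skip_outer_breaks Skip = Skip"
| "skip_outer_breaks Fail = Fail"
| "skip_outer_breaks (Seq P Q) = Seq (skip_outer_breaks P) (skip_outer_breaks Q)"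
| "skip_outer_breaks (Or P Q) = Or (skip_outer_breaks P) (skip_outer_breaks Q)"
| "skip_outer_breaks (If C P Q) =
     If (skip_outer_breaks C) (skip_outer_breaks P) (skip_outer_breaks Q)"
| "skip_outer_breaks (Try C P Q) =
     Try (skip_outer_breaks C) (skip_outer_breaks P) (skip_outer_breaks Q)"
| "skip_outer_breaks (Alap P) = Alap P"


section \<open>Assertions and the proof calculus\<close>

type_synonym assertion = "host_graph \<Rightarrow> bool"

definition implies :: "assertion \<Rightarrow> assertion \<Rightarrow> bool" where
  "implies c d \<longleftrightarrow> (\<forall>G. c G \<longrightarrow> d G)"

definition SUCCESS :: "prog \<Rightarrow> assertion" where
  "SUCCESS P G \<longleftrightarrow> (\<exists>H. Result H \<in> sem P G)"

definition FAIL :: "prog \<Rightarrow> assertion" where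
  "FAIL P G \<longleftrightarrow> Failed \<in> sem P G"

definition rule_correct :: "assertion \<Rightarrow> rule \<Rightarrow> assertion \<Rightarrow> bool" where
  "rule_correct c r d \<longleftrightarrow> (\<forall>G H. c G \<and> rule_step r G H \<longrightarrow> d H)"

definition is_SLP :: "assertion \<Rightarrow> rule \<Rightarrow> assertion \<Rightarrow> bool" where
  "is_SLP c r d \<longleftrightarrow> rule_correct c r d \<and> (\<forall>d'. rule_correct c r d' \<longrightarrow> implies d d')"

definition is_WLP :: "rule \<Rightarrow> assertion \<Rightarrow> assertion \<Rightarrow> bool" where
  "is_WLP r d c \<longleftrightarrow> rule_correct c r d \<and> (\<forall>c'. rule_correct c' r d \<longrightarrow> implies c' c)"

definition break_correct :: "assertion \<Rightarrow> prog \<Rightarrow> assertion \<Rightarrow> bool" where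
  "break_correct c P d \<longleftrightarrow>
     (\<forall>G H. step\<^sup>*\<^sup>* (Cmd P G) (Cmd Break H) \<longrightarrow> c G \<longrightarrow> d H)"

definition partially_correct :: "assertion \<Rightarrow> prog \<Rightarrow> assertion \<Rightarrow> bool" where
  "partially_correct c P d \<longleftrightarrow> (\<forall>G H. c G \<and> Result H \<in> sem P G \<longrightarrow> d H)"

text \<open>
  The first eight rules are the calculus SEM. They have no conclusion about break, nor about the
  derived commands skip, fail and or, so that no triple for these commands has a proof tree; the
  remaining rules, present if \<open>ext\<close> holds, supply them. Since a loop body that reaches break has
  no result of its own, any triple for break inside of a loop is partially correct. As the
  premises of a rule only involve parts of the program in its conclusion, the additional rules
  contribute nothing to programs that do not contain these commands.
\<close>

inductive derivable :: "bool \<Rightarrow> assertion \<Rightarrow> prog \<Rightarrow> assertion \<Rightarrow> bool" for ext where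
  ruleapp_slp: "is_SLP c r d \<Longrightarrow> derivable ext c (Call {|r|}) d"
| ruleapp_wlp: "is_WLP r d c \<Longrightarrow> derivable ext c (Call {|r|}) d"
| ruleset: "(\<And>r. r |\<in>| R \<Longrightarrow> derivable ext c (Call {|r|}) d) \<Longrightarrow> derivable ext c (Call R) d"
| comp: "derivable ext c P e \<Longrightarrow> derivable ext e Q d \<Longrightarrow> derivable ext c (Seq P Q) d"
| cons: "implies c c' \<Longrightarrow> derivable ext c' P d' \<Longrightarrow> implies d' d \<Longrightarrow> derivable ext c P d"
| if_rule: "derivable ext (\<lambda>G. c G \<and> SUCCESS C G) P d \<Longrightarrow>
    derivable ext (\<lambda>G. c G \<and> FAIL C G) Q d \<Longrightarrow> derivable ext c (If C P Q) d"
| try_rule: "derivable ext (\<lambda>G. c G \<and> SUCCESS C G) (Seq C P) d \<Longrightarrow>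
    derivable ext (\<lambda>G. c G \<and> FAIL C G) Q d \<Longrightarrow> derivable ext c (Try C P Q) d"
| alap: "derivable ext c P c \<Longrightarrow> break_correct c P d \<Longrightarrow>
    derivable ext c (Alap P) (\<lambda>G. (c G \<and> FAIL P G) \<or> d G)"
| ext_break: "ext \<Longrightarrow> derivable ext c Break d"
| ext_skip: "ext \<Longrightarrow> derivable ext c Skip c"
| ext_fail: "ext \<Longrightarrow> derivable ext c Fail d"
| ext_or: "ext \<Longrightarrow> derivable ext c P d \<Longrightarrow> derivable ext c Q d \<Longrightarrow> derivable ext c (Or P Q) d"

abbreviation SEM_provable :: "assertion \<Rightarrow> prog \<Rightarrow> assertion \<Rightarrow> bool" where
  "SEM_provable \<equiv> derivable False"

abbreviation SEM_ext_provable :: "assertion \<Rightarrow> prog \<Rightarrow> assertion \<Rightarrow> bool" where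
  "SEM_ext_provable \<equiv> derivable True"

text \<open>
  The programs whose commands are all covered by SEM. The condition C of \<open>If C P Q\<close> is arbitrary,
  because SEM refers to it through its semantics only.
\<close>

primrec covered :: "prog \<Rightarrow> bool" where
  "covered (Call R) = True"
| "covered Break = False"
| "covered Skip = False"
| "covered Fail = False"
| "covered (Seq P Q) = (covered P \<and> covered Q)"
| "covered (Or P Q) = False"
| "covered (If C P Q) = (covered P \<and> covered Q)"
| "covered (Try C P Q) = (covered C \<and> covered P \<and> covered Q)"
| "covered (Alap P) = covered P"

lemma SEM_provable_imp_covered: "SEM_provable c P d \<Longrightarrow> covered P"
  by (induction rule: derivable.induct) auto

lemma not_covered_counterexample:
  assumes "\<not> covered P"
  shows "partially_correct (\<lambda>_. False) P (\<lambda>_. True)"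
    and "\<not> SEM_provable (\<lambda>_. False) P (\<lambda>_. True)"
  using assms SEM_provable_imp_covered by (auto simp: partially_correct_def)

text \<open>The calculus with the additional rules is sound, so they do not make provability trivial.\<close>

inductive_cases step_SeqE: "Cmd (Seq P Q) G \<leadsto> k"
inductive_cases step_IfE: "Cmd (If C P Q) G \<leadsto> k"
inductive_cases step_TryE: "Cmd (Try C P Q) G \<leadsto> k"
inductive_cases step_AlapE: "Cmd (Alap P) G \<leadsto> k"
inductive_cases step_OrE: "Cmd (Or P Q) G \<leadsto> k"
inductive_cases step_SkipE: "Cmd Skip G \<leadsto> k"
inductive_cases step_FailE: "Cmd Fail G \<leadsto> k"
inductive_cases step_BreakE: "Cmd Break G \<leadsto> k"
inductive_cases step_CallE: "Cmd (Call R) G \<leadsto> k"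
inductive_cases step_GraphE: "Graph G \<leadsto> k"
inductive_cases step_FailureE: "Failure \<leadsto> k"

lemma Result_iff: "Result H \<in> sem P G \<longleftrightarrow> step\<^sup>+\<^sup>+ (Cmd P G) (Graph H)"
  by (auto simp: sem_def)

lemma Failed_iff: "Failed \<in> sem P G \<longleftrightarrow> step\<^sup>+\<^sup>+ (Cmd P G) Failure"
  by (auto simp: sem_def)

lemma tranclp_iff_rtranclp: "step\<^sup>+\<^sup>+ (Cmd P G) (Graph H) \<longleftrightarrow> step\<^sup>*\<^sup>* (Cmd P G) (Graph H)"
  by (auto dest: tranclp_into_rtranclp rtranclpD)

lemma Graph_final: "step\<^sup>*\<^sup>* (Graph G) k \<longleftrightarrow> k = Graph G"
  by (auto elim: converse_rtranclpE step_GraphE)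

lemma Failure_final: "step\<^sup>*\<^sup>* Failure k \<longleftrightarrow> k = Failure"
  by (auto elim: converse_rtranclpE step_FailureE)

lemma first_step:
  assumes "step\<^sup>*\<^sup>* (Cmd P G) (Graph H)"
  obtains k where "Cmd P G \<leadsto> k" and "step\<^sup>*\<^sup>* k (Graph H)"
  using assms by (auto elim: converse_rtranclpE)

lemma Seq_result:
  assumes "step\<^sup>*\<^sup>* (Cmd (Seq P Q) G) (Graph H')"
  shows "\<exists>H. step\<^sup>*\<^sup>* (Cmd P G) (Graph H) \<and> step\<^sup>*\<^sup>* (Cmd Q H) (Graph H')"
  using assms
proof (induction "Cmd (Seq P Q) G" arbitrary: P G rule: converse_rtranclp_induct)
  case (step k)
  from step.hyps(1) show ?case
  proof cases
    case (seq1 P' H)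
    then obtain J where "step\<^sup>*\<^sup>* (Cmd P' H) (Graph J)" "step\<^sup>*\<^sup>* (Cmd Q J) (Graph H')"
      using step.hyps(3) by blast
    with seq1 show ?thesis by (meson converse_rtranclp_into_rtranclp)
  next
    case (seq2 H)
    then show ?thesis using step.hyps(2) by blast
  next
    case seq3
    then show ?thesis using step.hyps(2) by (simp add: Failure_final)
  next
    case break
    then show ?thesis using step.hyps(2) by (auto elim: first_step step_BreakE)
  qed
qed

lemma Alap_result:
  assumes "step\<^sup>*\<^sup>* (Cmd (Alap P) G) (Graph H')" and "c G"
    and "partially_correct c P c" and "break_correct c P d"
  shows "(c H' \<and> FAIL P H') \<or> d H'"
  using assms(1,2)
proof (induction "Cmd (Alap P) G" arbitrary: G rule: converse_rtranclp_induct)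
  case (step k)
  from step.hyps(1) show ?case
  proof cases
    case (alap1 H)
    then show ?thesis
      using step.hyps(3) step.prems assms(3) by (auto simp: partially_correct_def Result_iff)
  next
    case alap2
    then show ?thesis using step.hyps(2) step.prems by (simp add: Graph_final FAIL_def Failed_iff)
  next
    case (alap3 H)
    then show ?thesis
      using step.hyps(2) step.prems assms(4) by (auto simp: Graph_final break_correct_def)
  qed
qed

theorem derivable_sound: "derivable ext c P d \<Longrightarrow> partially_correct c P d"
proof (induction rule: derivable.induct)
  case (ruleapp_slp c r d)
  then show ?case
    by (auto simp: partially_correct_def Result_iff tranclp_iff_rtranclp is_SLP_def
        rule_correct_def Graph_final Failure_final elim!: first_step step_CallE)
next
  case (ruleapp_wlp r d c)
  then show ?case
    by (auto simp: partially_correct_def Result_iff tranclp_iff_rtranclp is_WLP_def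
        rule_correct_def Graph_final Failure_final elim!: first_step step_CallE)
next
  case (ruleset R c d)
  have "d H" if "r |\<in>| R" "rule_step r G H" "c G" for r G H
    using ruleset.IH[OF that(1)] that step.call1[of r "{|r|}" G H]
    by (auto simp: partially_correct_def Result_iff)
  then show ?case
    by (auto simp: partially_correct_def Result_iff tranclp_iff_rtranclp
        Graph_final Failure_final elim!: first_step step_CallE)
next
  case (comp c P e Q d)
  then show ?case
    by (auto simp: partially_correct_def Result_iff tranclp_iff_rtranclp dest!: Seq_result)
next
  case (cons c c' P d' d)
  then show ?case by (auto simp: partially_correct_def implies_def)
next
  case (if_rule c C P d Q)
  then show ?case
    by (auto simp: partially_correct_def Result_iff SUCCESS_def FAIL_def Failed_iff
        tranclp_iff_rtranclp elim!: first_step[of "If C P Q"] step_IfE) blast+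
next
  case (try_rule c C P d Q)
  have seq: "step\<^sup>*\<^sup>* (Cmd (Seq C P) G) (Graph H')"
    if "step\<^sup>*\<^sup>* (Cmd C G) (Graph H)" "step\<^sup>*\<^sup>* (Cmd P H) (Graph H')" for G H H'
    using that
  proof (induction "Cmd C G" arbitrary: C G rule: converse_rtranclp_induct)
    case (step k)
    then show ?case
      by (cases k)
        (auto simp: Graph_final Failure_final
          intro: converse_rtranclp_into_rtranclp step.seq1 step.seq2)
  qed
  show ?case
    using try_rule.IH seq
    by (auto simp: partially_correct_def Result_iff SUCCESS_def FAIL_def Failed_iff
        tranclp_iff_rtranclp elim!: first_step[of "Try C P Q"] step_TryE) blast+
next
  case (alap c P d)
  then show ?case
    using Alap_result[of P _ _ c d]
    unfolding partially_correct_def[of c "Alap P"] Result_iff tranclp_iff_rtranclp by blast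
next
  case (ext_break c d)
  then show ?case
    by (auto simp: partially_correct_def Result_iff tranclp_iff_rtranclp
        elim!: first_step step_BreakE)
next
  case (ext_skip c)
  then show ?case
    by (auto simp: partially_correct_def Result_iff tranclp_iff_rtranclp Graph_final
        elim!: first_step[of Skip] step_SkipE)
next
  case (ext_fail c d)
  then show ?case
    by (auto simp: partially_correct_def Result_iff tranclp_iff_rtranclp Failure_final
        elim!: first_step[of Fail] step_FailE)
next
  case (ext_or c P d Q)
  then show ?case
    by (auto simp: partially_correct_def Result_iff tranclp_iff_rtranclp
        elim!: first_step[of "Or P Q"] step_OrE)
qed

end

theory Submission
  imports Defs
begin

text \<open>
  Every program has a weakest liberal precondition, because assertions are arbitrary properties
  of host graphs. The precondition of \<open>Q\<close> is the intermediate assertion of \<open>P; Q\<close>. The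
  precondition of \<open>P!\<close> is its own loop invariant: it is preserved by \<open>P\<close>, it implies the
  postcondition at graphs where \<open>P\<close> fails, and every break reached from it ends in the
  postcondition, as each of these steps of the body is a step of the loop.
\<close>

definition weakest_pre :: "prog \<Rightarrow> assertion \<Rightarrow> assertion" where
  "weakest_pre P d G \<longleftrightarrow> (\<forall>H. Result H \<in> sem P G \<longrightarrow> d H)"

lemma partially_correct_iff_implies_weakest_pre:
  "partially_correct c P d \<longleftrightarrow> implies c (weakest_pre P d)"
  by (auto simp: partially_correct_def implies_def weakest_pre_def)

lemma partially_correct_weakest_pre: "partially_correct (weakest_pre P d) P d"
  by (auto simp: partially_correct_def weakest_pre_def)

text \<open>Read contrapositively, \<open>weakest_pre\<close> passes along steps: if
  \<open>weakest_pre P d\<close> holds at \<open>G\<close>, then \<open>weakest_pre Q d\<close>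
  holds at \<open>H\<close>.\<close>

lemma Result_step:
  assumes "Cmd P G \<leadsto> Cmd Q H" and "Result K \<in> sem Q H"
  shows "Result K \<in> sem P G"
  using assms by (auto simp: Result_iff intro: tranclp_into_tranclp2)

lemma Result_Seq:
  assumes "Result H \<in> sem P G" and "Result K \<in> sem Q H"
  shows "Result K \<in> sem (Seq P Q) G"
proof -
  have "step\<^sup>*\<^sup>* (Cmd P G) (Graph H)"
    using assms(1) by (simp add: Result_iff tranclp_iff_rtranclp)
  \<comment> \<open>The run of \<open>P\<close> is replayed in the left component:
    \<open>seq1\<close> lifts each step but the last, \<open>seq2\<close> the last.\<close>
  then have "step\<^sup>*\<^sup>* (Cmd (Seq P Q) G) (Cmd Q H)"
  proof (induction "Cmd P G" arbitrary: P G rule: converse_rtranclp_induct)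
    case (step k)
    then show ?case
      by (cases k)
        (auto simp: Graph_final Failure_final
          intro: converse_rtranclp_into_rtranclp step.seq1 step.seq2)
  qed
  with assms(2) show ?thesis by (auto simp: Result_iff)
qed

text \<open>A break in \<open>P\<close> adds no result, since \<open>Seq Break Q\<close> only steps
  to \<open>Break\<close>, which is final.\<close>

lemma Result_Seq_iff:
  "Result K \<in> sem (Seq P Q) G \<longleftrightarrow> (\<exists>H. Result H \<in> sem P G \<and> Result K \<in> sem Q H)"
  using Result_Seq by (auto simp: Result_iff tranclp_iff_rtranclp dest: Seq_result)

lemma partially_correct_Seq_weakest_pre:
  assumes "partially_correct c (Seq P Q) d"
  shows "partially_correct c P (weakest_pre Q d)"
  using assms by (auto simp: partially_correct_def weakest_pre_def Result_Seq_iff)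

lemma weakest_pre_Alap_invariant:
  "partially_correct (weakest_pre (Alap P) d) P (weakest_pre (Alap P) d)"
  unfolding partially_correct_def weakest_pre_def
  by (metis Result_iff Result_step alap1)

lemma weakest_pre_Alap_break_correct: "break_correct (weakest_pre (Alap P) d) P d"
  by (auto simp: break_correct_def weakest_pre_def Result_iff intro: alap3)

lemma weakest_pre_Alap_exit:
  assumes "weakest_pre (Alap P) d G" and "FAIL P G"
  shows "d G"
  using assms by (auto simp: weakest_pre_def FAIL_def Failed_iff Result_iff intro: alap2)

lemma rule_correct_if_partially_correct_Call:
  assumes "partially_correct c (Call R) d" and "r |\<in>| R"
  shows "rule_correct c r d"
  using assms by (auto simp: partially_correct_def rule_correct_def Result_iff intro: call1)

lemma derivable_single_rule:
  assumes "rule_correct c r d"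
  shows "derivable ext c (Call {|r|}) d"
proof -
  \<comment> \<open>Assertions are arbitrary predicates, so the weakest liberal precondition can be
    written down directly.\<close>
  let ?w = "\<lambda>G. \<forall>H. rule_step r G H \<longrightarrow> d H"
  have "is_WLP r d ?w"
    by (auto simp: is_WLP_def rule_correct_def implies_def)
  then have "derivable ext ?w (Call {|r|}) d"
    by (rule ruleapp_wlp)
  moreover have "implies c ?w"
    using assms by (auto simp: rule_correct_def implies_def)
  ultimately show ?thesis
    by (auto intro: cons simp: implies_def)
qed

text \<open>One induction serves both calculi: at the commands outside SEM, \<open>covered\<close>
  is false, so \<open>ext\<close> holds and the additional rules apply.\<close>

theorem derivable_complete:
  assumes "partially_correct c P d" and "ext \<or> covered P"
  shows "derivable ext c P d"
  using assms
proof (induction P arbitrary: c d)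
  case (Call R)
  then show ?case
    by (blast intro: ruleset derivable_single_rule rule_correct_if_partially_correct_Call)
next
  case Break
  then show ?case by (simp add: ext_break)
next
  case Skip
  have "implies c d"
    using Skip.prems(1) by (auto simp: partially_correct_def implies_def Result_iff intro: skip)
  with Skip.prems(2) show ?case
    by (auto intro: cons[OF _ ext_skip] simp: implies_def)
next
  case Fail
  then show ?case by (simp add: ext_fail)
next
  case (Seq P Q)
  then show ?case
    by (auto intro!: comp partially_correct_Seq_weakest_pre partially_correct_weakest_pre)
next
  case (Or P Q)
  have "partially_correct c P d" "partially_correct c Q d"
    using Or.prems(1) or1 or2 unfolding partially_correct_def by (metis Result_step)+
  with Or show ?case by (auto intro: ext_or)
next
  case (If C P Q)
  have "partially_correct (\<lambda>G. c G \<and> SUCCESS C G) P d"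
    using If.prems(1) unfolding partially_correct_def SUCCESS_def
    by (metis Result_iff Result_step if1)
  moreover have "partially_correct (\<lambda>G. c G \<and> FAIL C G) Q d"
    using If.prems(1) unfolding partially_correct_def FAIL_def
    by (metis Failed_iff Result_step if2)
  ultimately show ?case
    using If.IH(2,3) If.prems(2) by (auto intro!: if_rule)
next
  case (Try C P Q)
  have "partially_correct (\<lambda>G. c G \<and> SUCCESS C G) (Seq C P) d"
    using Try.prems(1) unfolding partially_correct_def Result_Seq_iff
    by (metis Result_iff Result_step try1)
  \<comment> \<open>\<open>Seq C P\<close> is not a subprogram of \<open>Try C P Q\<close>, so its
    triple is assembled from the hypotheses for \<open>C\<close> and \<open>P\<close>, with
    \<open>weakest_pre P d\<close> in between.\<close>
  then have "derivable ext (\<lambda>G. c G \<and> SUCCESS C G) (Seq C P) d"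
    using Try.IH(1,2) Try.prems(2)
    by (auto intro!: comp partially_correct_Seq_weakest_pre partially_correct_weakest_pre)
  moreover have "partially_correct (\<lambda>G. c G \<and> FAIL C G) Q d"
    using Try.prems(1) unfolding partially_correct_def FAIL_def
    by (metis Failed_iff Result_step try2)
  ultimately show ?case
    using Try.IH(3) Try.prems(2) by (auto intro!: try_rule)
next
  case (Alap P)
  let ?w = "weakest_pre (Alap P) d"
  have "derivable ext ?w P ?w"
    using Alap.IH[OF weakest_pre_Alap_invariant] Alap.prems(2) by simp
  \<comment> \<open>Taking \<open>d\<close> itself as break postcondition makes both disjuncts imply
    \<open>d\<close>.\<close>
  then have "derivable ext ?w (Alap P) (\<lambda>G. ?w G \<and> FAIL P G \<or> d G)"
    by (rule alap[OF _ weakest_pre_Alap_break_correct])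
  then show ?case
    using Alap.prems(1)
    by (rule_tac cons) (auto simp: partially_correct_iff_implies_weakest_pre implies_def
        intro: weakest_pre_Alap_exit)
qed

text \<open>In a covered program \<open>Break\<close> occurs only within conditions of
  \<open>If\<close>, which \<open>covered\<close> does not inspect.\<close>

lemma covered_skip_outer_breaks: "covered P \<Longrightarrow> covered (skip_outer_breaks P)"
  by (induction P) auto

theorem theorem6:
  fixes P :: prog and c d :: assertion
  assumes "partially_correct c (skip_outer_breaks P) d"
  shows "SEM_ext_provable c (skip_outer_breaks P) d \<and>
    (covered P \<longrightarrow> SEM_provable c (skip_outer_breaks P) d)"
  using assms by (simp add: derivable_complete covered_skip_outer_breaks)

end
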